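(* Let $k$ be a parameter (with $n/k$ an integer) and let $C$ be an input array of $N$ integers each drawn independently and uniformly from $\{0,\dots,2^n-1\}$. Then there is a constant $c>0$ such that $$\Pr\left[\frac{\mathrm{wkt}_C(\vec e_{\mathsf o})}{\mathrm{wkt}_C(\vec e_{\mathsf t})}\le c\,\frac{2^{n(k-5/3)/6}}{N\log N}\right]=O\!\left(\frac{N^2}{2^{n/\max(3,k)}}\right).$$ Consequently, for constant $k>5/3$, if bad inputs are those for which $\frac{\mathrm{wkt}_C(\vec e_{\mathsf o})}{\mathrm{wkt}_C(\vec e_{\mathsf t})}\le c\,\frac{2^{n(k-5/3)/6}}{N\log N}$ and good inputs are the remaining ones, then the ratio of the number of good inputs to the number of bad inputs is $\Omega\!\left(\frac{2^{n/\max(3,k)}}{N^2}\right)$.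
   Context: Integers are $n$-bit, bits indexed $1$ (least significant) to $n$ (most significant); array entries are assumed distinct. An energy vector $\vec e=(e_1,\dots,e_n)$ assigns energy $e_j\ge0$ to bit $j$. An inexact comparison of $u,v$ with $\vec e$ reads each bit $j$ of $u$ and of $v$ independently, flipped with probability $2^{-e_j}$, and orders $u,v$ by the read values; comparisons use fresh independent randomness. Arrays are sorted by randomized quicksort (uniform random pivot, partition by inexact comparisons with the pivot, recursion). $Q(u,v,\vec e)$ is the event that in the output $u,v$ are in the wrong relative order; $\mathrm{wkt}_C(\vec e)=\sum_{1\le a<b\le N}|C[a]-C[b]|\cdot\Pr[Q(C[a],C[b],\vec e)]$ (probability over pivots and comparison errors). $\vec e_{\mathsf o}=(\frac{n+1}{2},\dots,\frac{n+1}{2})$. The variable-precision vector $\vec e_{\mathsf t}$ assigns energy $0$ to bits $1,\dots,n-n/k$ and energy $nk/2$ to each of the $n/k$ most significant bits $n-n/k+1,\dots,n$ (total energy $n^2/2$). *)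

theory Defs
  imports "HOL-Probability.Probability"
begin

text \<open>Integers are n-bit natural numbers in {0..<2^n}. Bit j (1-based, j = 1 least
  significant) of u is  bit u (j - 1).  An energy vector is a function e :: nat => real,
  e j being the energy of bit j (only j = 1..n matter).\<close>

definition flip_prob :: "(nat \<Rightarrow> real) \<Rightarrow> nat \<Rightarrow> real" where
  "flip_prob e j = 2 powr (- e j)"

primrec read_val :: "(nat \<Rightarrow> real) \<Rightarrow> nat \<Rightarrow> nat \<Rightarrow> nat pmf" where
  "read_val e 0 u = return_pmf 0"
| "read_val e (Suc m) u =
     bind_pmf (read_val e m u) (\<lambda>r.
     bind_pmf (bernoulli_pmf (flip_prob e (Suc m))) (\<lambda>f.
     return_pmf (r + (if bit u m \<noteq> f then 2 ^ m else 0))))"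

definition inexact_less :: "(nat \<Rightarrow> real) \<Rightarrow> nat \<Rightarrow> nat \<Rightarrow> nat \<Rightarrow> bool pmf" where
  "inexact_less e n u v =
     bind_pmf (read_val e n u) (\<lambda>a. bind_pmf (read_val e n v) (\<lambda>b. return_pmf (a < b)))"

primrec partition_pmf ::
  "(nat \<Rightarrow> real) \<Rightarrow> nat \<Rightarrow> nat list \<Rightarrow> nat \<Rightarrow> nat list \<Rightarrow> (nat list \<times> nat list) pmf" where
  "partition_pmf e n C p [] = return_pmf ([], [])"
| "partition_pmf e n C p (x # xs) =
     bind_pmf (inexact_less e n (C ! x) (C ! p)) (\<lambda>b.
     bind_pmf (partition_pmf e n C p xs) (\<lambda>lr.
     return_pmf (if b then (x # fst lr, snd lr) else (fst lr, x # snd lr))))"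

text \<open>Randomized quicksort (uniform random pivot) of a list of positions of C,
  with a fuel argument (fuel >= length of the list suffices to finish).\<close>
primrec qs_fuel ::
  "(nat \<Rightarrow> real) \<Rightarrow> nat \<Rightarrow> nat list \<Rightarrow> nat \<Rightarrow> nat list \<Rightarrow> nat list pmf" where
  "qs_fuel e n C 0 xs = return_pmf xs"
| "qs_fuel e n C (Suc f) xs =
     (if xs = [] then return_pmf [] else
      bind_pmf (pmf_of_set {0..<length xs}) (\<lambda>i.
      bind_pmf (partition_pmf e n C (xs ! i) (take i xs @ drop (Suc i) xs)) (\<lambda>lr.
      bind_pmf (qs_fuel e n C f (fst lr)) (\<lambda>l.
      bind_pmf (qs_fuel e n C f (snd lr)) (\<lambda>r.
      return_pmf (l @ (xs ! i) # r))))))"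

definition quicksort :: "(nat \<Rightarrow> real) \<Rightarrow> nat \<Rightarrow> nat list \<Rightarrow> nat list pmf" where
  "quicksort e n C = qs_fuel e n C (length C) [0..<length C]"

definition wrong_order :: "nat list \<Rightarrow> nat \<Rightarrow> nat \<Rightarrow> nat list \<Rightarrow> bool" where
  "wrong_order C a b out \<longleftrightarrow>
     filter (\<lambda>i. i = a \<or> i = b) out = (if C ! a < C ! b then [b, a] else [a, b])"

definition wkt :: "(nat \<Rightarrow> real) \<Rightarrow> nat \<Rightarrow> nat list \<Rightarrow> real" where
  "wkt e n C = (\<Sum>a<length C. \<Sum>b\<in>{a<..<length C}.
      \<bar>real (C ! a) - real (C ! b)\<bar> *
      measure_pmf.prob (quicksort e n C) {out. wrong_order C a b out})"

definition e_o :: "nat \<Rightarrow> nat \<Rightarrow> real" where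
  "e_o n j = (real n + 1) / 2"

definition e_t :: "nat \<Rightarrow> real \<Rightarrow> nat \<Rightarrow> real" where
  "e_t n k j = (if real n - real n / k < real j then real n * k / 2 else 0)"

definition inputs :: "nat \<Rightarrow> nat \<Rightarrow> nat list set" where
  "inputs n N = {C. length C = N \<and> set C \<subseteq> {..<2 ^ n}}"

definition input_dist :: "nat \<Rightarrow> nat \<Rightarrow> nat list pmf" where
  "input_dist n N = pmf_of_set (inputs n N)"

definition is_bad :: "real \<Rightarrow> real \<Rightarrow> nat \<Rightarrow> nat list \<Rightarrow> bool" where
  "is_bad c k n C \<longleftrightarrow>
     wkt (e_o n) n C / wkt (e_t n k) n C
       \<le> c * 2 powr (real n * (k - 5 / 3) / 6) / (real (length C) * ln (real (length C)))"

definition bad_inputs :: "real \<Rightarrow> real \<Rightarrow> nat \<Rightarrow> nat \<Rightarrow> nat list set" where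
  "bad_inputs c k n N = {C \<in> inputs n N. is_bad c k n C}"

definition good_inputs :: "real \<Rightarrow> real \<Rightarrow> nat \<Rightarrow> nat \<Rightarrow> nat list set" where
  "good_inputs c k n N = {C \<in> inputs n N. \<not> is_bad c k n C}"

end

theory Submission
  imports Defs
begin

text \<open>
  Whether quicksort outputs two entries in the wrong order is decided by the first pivot that separates
  them. So for every energy vector the probability of a wrong order lies between \<open>(1/N) \<Sigma>\<^sub>p s\<^sub>p\<close> and
  \<open>\<Sigma>\<^sub>p s\<^sub>p\<close>, where \<open>s\<^sub>p\<close> is the probability that pivot \<open>p\<close> separates them wrongly; each \<open>s\<^sub>p\<close> is a
  product of at most two comparison probabilities, at least one of which is an error probability. This
  reduces the ratio of the two \<open>wkt\<close> values, up to a factor \<open>1/N\<close>, to the ratio of the error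
  probabilities of a single comparison.

  Let \<open>m = n/k\<close> and suppose the two compared numbers differ in one of the \<open>m\<close> top bits other than the
  most significant one. Then either a single flip suffices to err under \<open>e_o\<close>, while at least one flip
  among the top \<open>m\<close> bits is needed under \<open>e_t\<close>; or two flips of the most significant bits suffice under
  \<open>e_o\<close>, while two are needed under \<open>e_t\<close>. The flip probabilities are \<open>2\<^bsup>-(n+1)/2\<^esup>\<close> and \<open>2\<^bsup>-nk/2\<^esup>\<close>,
  so the ratio is at least of order \<open>2\<^bsup>n(k-1)/2\<^esup>/n\<^sup>4\<close>, which beats \<open>2\<^bsup>n(k-5/3)/6\<^esup>\<close> by the factor
  \<open>2\<^bsup>n/9\<^esup>/n\<^sup>4\<close> even at \<open>k = 1\<close>. A given pair of random entries violates the assumption with probability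
  \<open>2\<^bsup>1-m\<^esup>\<close>, and a union bound over the pairs finishes the proof. The bits of energy \<open>0\<close>, which \<open>e_t\<close>
  flips with certainty, play no role.
\<close>

subsection \<open>Comparisons\<close>

text \<open>The flag \<open>S\<close> decides ties. Both versions occur: the complement of a strict
  comparison is a non-strict one with the arguments swapped.\<close>

definition cmp_pmf :: "bool \<Rightarrow> (nat \<Rightarrow> real) \<Rightarrow> nat \<Rightarrow> nat \<Rightarrow> nat \<Rightarrow> bool pmf" where
  "cmp_pmf S e n u v =
     bind_pmf (read_val e n u) (\<lambda>a. bind_pmf (read_val e n v) (\<lambda>b. return_pmf (a < b \<or> S \<and> a = b)))"

definition less_prob :: "bool \<Rightarrow> (nat \<Rightarrow> real) \<Rightarrow> nat \<Rightarrow> nat \<Rightarrow> nat \<Rightarrow> real" where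
  "less_prob S e n u v = pmf (cmp_pmf S e n u v) True"

lemma pmf_inexact_less_True: "pmf (inexact_less e n u v) True = less_prob False e n u v"
  by (simp add: less_prob_def cmp_pmf_def inexact_less_def)

lemma less_prob_bounds: "0 \<le> less_prob S e n u v" "less_prob S e n u v \<le> 1"
  by (simp_all add: less_prob_def pmf_le_1)

lemma set_pmf_read_val: "r \<in> set_pmf (read_val e n u) \<Longrightarrow> r < 2 ^ n"
proof (induction n arbitrary: r)
  case (Suc n)
  then obtain r' where "r' < 2 ^ n" "r \<le> r' + 2 ^ n"
    by (fastforce split: if_splits)
  then show ?case by simp
qed simp

text \<open>Lower bits contribute less than \<open>2 ^ n\<close>, so two top bits read differently
  settle the comparison. This recursion from the most significant bit drives all later
  bounds.\<close>

lemma cmp_pmf_Suc: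
  "cmp_pmf S e (Suc n) u v =
     bind_pmf (bernoulli_pmf (flip_prob e (Suc n))) (\<lambda>x.
     bind_pmf (bernoulli_pmf (flip_prob e (Suc n))) (\<lambda>y.
       if (bit u n \<noteq> x) = (bit v n \<noteq> y) then cmp_pmf S e n u v else return_pmf (bit v n \<noteq> y)))"
proof -
  let ?B = "bernoulli_pmf (flip_prob e (Suc n))"
  let ?t = "\<lambda>b. if b then 2 ^ n else (0::nat)"
  let ?f = "\<lambda>x y r s. return_pmf (r + ?t (bit u n \<noteq> x) < s + ?t (bit v n \<noteq> y) \<or>
      S \<and> r + ?t (bit u n \<noteq> x) = s + ?t (bit v n \<noteq> y))"
  have inner: "bind_pmf (read_val e n u) (\<lambda>r. bind_pmf (read_val e n v) (?f x y r)) =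
    (if (bit u n \<noteq> x) = (bit v n \<noteq> y) then cmp_pmf S e n u v else return_pmf (bit v n \<noteq> y))"
    for x y
  proof (cases "(bit u n \<noteq> x) = (bit v n \<noteq> y)")
    case True
    then show ?thesis by (simp add: cmp_pmf_def)
  next
    case False
    have "bind_pmf (read_val e n u) (\<lambda>r. bind_pmf (read_val e n v) (?f x y r)) =
        bind_pmf (read_val e n u) (\<lambda>r. bind_pmf (read_val e n v) (\<lambda>s. return_pmf (bit v n \<noteq> y)))"
    proof (intro bind_pmf_cong refl arg_cong[where f = return_pmf])
      fix r s assume "r \<in> set_pmf (read_val e n u)" "s \<in> set_pmf (read_val e n v)"
      then have "r < 2 ^ n" "s < 2 ^ n" by (auto dest: set_pmf_read_val)
      with False show "(r + ?t (bit u n \<noteq> x) < s + ?t (bit v n \<noteq> y) \<or>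
          S \<and> r + ?t (bit u n \<noteq> x) = s + ?t (bit v n \<noteq> y)) = (bit v n \<noteq> y)"
        by (auto split: if_splits)
    qed
    then show ?thesis by (simp only: False if_False bind_pmf_const)
  qed
  \<comment> \<open>The reads are independent, so both top flips may be drawn before the lower
    bits.\<close>
  have "cmp_pmf S e (Suc n) u v =
    bind_pmf (read_val e n u) (\<lambda>r. bind_pmf ?B (\<lambda>x. bind_pmf (read_val e n v) (\<lambda>s. bind_pmf ?B (\<lambda>y. ?f x y r s))))"
    by (simp add: cmp_pmf_def bind_assoc_pmf bind_return_pmf)
  also have "\<dots> = bind_pmf ?B (\<lambda>x. bind_pmf (read_val e n u) (\<lambda>r. bind_pmf ?B (\<lambda>y. bind_pmf (read_val e n v) (\<lambda>s. ?f x y r s))))"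
    by (subst bind_commute_pmf, subst (2) bind_commute_pmf) (rule refl)
  also have "\<dots> = bind_pmf ?B (\<lambda>x. bind_pmf ?B (\<lambda>y. bind_pmf (read_val e n u) (\<lambda>r. bind_pmf (read_val e n v) (?f x y r))))"
    by (subst (2) bind_commute_pmf) (rule refl)
  finally show ?thesis by (simp only: inner)
qed

text \<open>The factor of \<open>less_prob S e n u v\<close> is the probability that the top bits
  are read as equal; the other summand is the probability that they are read as 0 for
  \<open>u\<close> and 1 for \<open>v\<close>.\<close>

lemma less_prob_Suc:
  assumes "f = flip_prob e (Suc n)" and "f \<le> 1"
  shows "less_prob S e (Suc n) u v =
    (if bit u n = bit v n then (f\<^sup>2 + (1 - f)\<^sup>2) * less_prob S e n u v + f * (1 - f)
     else 2 * f * (1 - f) * less_prob S e n u v + (if bit v n then (1 - f)\<^sup>2 else f\<^sup>2))"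
proof -
  have "0 \<le> f" using assms by (simp add: flip_prob_def)
  then show ?thesis
    using assms(2) unfolding less_prob_def cmp_pmf_Suc assms(1)[symmetric]
    by (simp add: pmf_bind) (simp add: power2_eq_square algebra_simps)
qed

lemma less_prob_0: "less_prob S e 0 u v = of_bool S"
  by (simp add: less_prob_def cmp_pmf_def bind_return_pmf)

text \<open>Negating \<open>a < b\<close> gives \<open>b \<le> a\<close>, so the event that an entry
  goes right of the pivot becomes a comparison with the pivot as first argument.\<close>

lemma less_prob_compl:
  assumes "\<And>j. 0 \<le> e j"
  shows "1 - less_prob S e n u v = less_prob (\<not> S) e n v u"
proof (induction n)
  case 0
  then show ?case by (simp add: less_prob_0)
next
  case (Suc n)
  define f where "f = flip_prob e (Suc n)"
  have "f \<le> 1" using assms powr_mono[of "- e (Suc n)" 0 2] by (simp add: f_def flip_prob_def)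
  note rec = less_prob_Suc[OF f_def this]
  show ?case
    by (auto simp: rec Suc[symmetric] power2_eq_square algebra_simps)
qed

section \<open>Bounds for one comparison by the number of flips required\<close>

lemma take_bit_Suc_less_cases:
  fixes u v :: nat
  assumes "take_bit (Suc n) u < take_bit (Suc n) v"
  obtains "bit u n = bit v n" "take_bit n u < take_bit n v" | "\<not> bit u n" "bit v n"
  using assms take_bit_nat_less_exp[of n u] take_bit_nat_less_exp[of n v]
  by (cases "bit u n"; cases "bit v n") (auto simp: take_bit_Suc_from_most)

text \<open>The bound is the probability that none of the \<open>2 * n\<close> bits read is flipped.
  Stating the order through \<open>take_bit\<close> makes the induction on the number of bits
  possible.\<close>

lemma less_prob_ge_no_flip:
  assumes flip: "\<And>j. flip_prob e j = p" and p: "p \<le> 1"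
    and "take_bit n u < take_bit n v"
  shows "(1 - p) ^ (2 * n) \<le> less_prob S e n u v"
  using assms(3)
proof (induction n)
  case (Suc n)
  have p0: "0 \<le> p" using flip[of 0] by (auto simp: flip_prob_def)
  note rec = less_prob_Suc[OF flip[symmetric] p]
  from Suc.prems show ?case
  proof (cases rule: take_bit_Suc_less_cases)
    case 1
    have "(1 - p) ^ (2 * Suc n) = (1 - p)\<^sup>2 * (1 - p) ^ (2 * n)"
      by (simp add: power2_eq_square)
    also have "\<dots> \<le> (1 - p)\<^sup>2 * less_prob S e n u v"
      using Suc.IH 1 by (intro mult_left_mono) auto
    also have "\<dots> \<le> (p\<^sup>2 + (1 - p)\<^sup>2) * less_prob S e n u v"
      by (intro mult_right_mono) (auto simp: less_prob_bounds)
    also have "\<dots> \<le> less_prob S e (Suc n) u v"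
      using 1 p p0 by (simp add: rec)
    finally show ?thesis .
  next
    case 2
    have "(1 - p) ^ (2 * Suc n) \<le> (1 - p)\<^sup>2"
      using p p0 by (intro power_decreasing) auto
    also have "\<dots> \<le> less_prob S e (Suc n) u v"
      using 2 p p0 by (simp add: rec less_prob_bounds)
    finally show ?thesis .
  qed
qed simp

text \<open>A union bound: as the numbers differ at or above position \<open>s\<close>, an error
  requires a flip among the \<open>2 * (n - s)\<close> reads there. Position \<open>i\<close> has
  energy index \<open>Suc i\<close>, hence \<open>s \<le> i\<close> against
  \<open>s < j\<close>.\<close>

lemma less_prob_le_one_flip:
  assumes flip: "\<And>j. s < j \<Longrightarrow> flip_prob e j = q" and q: "q \<le> 1"
    and "take_bit n v < take_bit n u" and "s \<le> i" "i < n" "bit u i \<noteq> bit v i"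
  shows "less_prob S e n u v \<le> 2 * real (n - s) * q"
  using assms(3-)
proof (induction n)
  case (Suc n)
  from Suc.prems have sn: "s \<le> n" by simp
  note fl = flip[of "Suc n"]
  have q0: "0 \<le> q" using fl sn by (auto simp: flip_prob_def)
  have rec: "less_prob S e (Suc n) u v =
    (if bit u n = bit v n then (q\<^sup>2 + (1 - q)\<^sup>2) * less_prob S e n u v + q * (1 - q)
     else 2 * q * (1 - q) * less_prob S e n u v + (if bit v n then (1 - q)\<^sup>2 else q\<^sup>2))"
    using sn q by (intro less_prob_Suc) (auto simp: fl)
  from Suc.prems(1) show ?case
  proof (cases rule: take_bit_Suc_less_cases)
    case 1
    with Suc.prems have "i < n" by (metis less_SucE)
    have "(q\<^sup>2 + (1 - q)\<^sup>2) * less_prob S e n u v \<le> 1 * less_prob S e n u v"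
    proof (rule mult_right_mono)
      have "q\<^sup>2 + (1 - q)\<^sup>2 = 1 - 2 * (q * (1 - q))" by (simp add: power2_eq_square algebra_simps)
      then show "q\<^sup>2 + (1 - q)\<^sup>2 \<le> 1" using q q0 by simp
    qed (simp add: less_prob_bounds)
    moreover have "less_prob S e n u v \<le> 2 * real (n - s) * q"
      using Suc.IH 1 Suc.prems \<open>i < n\<close> by auto
    moreover have "q * (1 - q) \<le> q" using q0 by (simp add: algebra_simps)
    moreover have "less_prob S e (Suc n) u v = (q\<^sup>2 + (1 - q)\<^sup>2) * less_prob S e n u v + q * (1 - q)"
      using 1 by (simp add: rec)
    moreover have "2 * real (Suc n - s) * q = 2 * real (n - s) * q + 2 * q"
      using sn by (simp add: Suc_diff_le algebra_simps)
    ultimately show ?thesis using q0 by linarith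
  next
    case 2
    have "2 * q * (1 - q) * less_prob S e n u v \<le> 2 * q * (1 - q) * 1"
      using q q0 by (intro mult_left_mono) (auto simp: less_prob_bounds)
    with 2 have "less_prob S e (Suc n) u v \<le> 2 * q * (1 - q) + q\<^sup>2" by (simp add: rec)
    also have "\<dots> \<le> 2 * 1 * q" by (simp add: power2_eq_square algebra_simps)
    also have "\<dots> \<le> 2 * real (Suc n - s) * q"
      using sn q0 by (intro mult_right_mono) auto
    finally show ?thesis .
  qed
qed simp

text \<open>Whatever the top bits are, they are read as 0 for \<open>u\<close> and 1 for
  \<open>v\<close> with positive probability.\<close>

lemma less_prob_pos:
  assumes "0 < n" "flip_prob e n < 1"
  shows "0 < less_prob S e n u v"
proof -
  obtain m where n: "n = Suc m" using assms(1) by (cases n) auto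
  define f where "f = flip_prob e (Suc m)"
  have f: "0 < f" "f < 1" using assms by (auto simp: f_def n flip_prob_def)
  have "0 \<le> x * less_prob S e m u v" if "0 \<le> x" for x using that less_prob_bounds by simp
  then show ?thesis
    using f by (simp add: n less_prob_Suc[OF f_def] add_nonneg_pos)
qed

text \<open>The first alternative holds if the most significant bits agree, or if they differ and the next
  differing bit points the other way; otherwise the second one does.\<close>

lemma wrong_less_prob_cases:
  assumes flip: "\<And>j. flip_prob e j = p" and p: "p \<le> 1"
    and flip': "\<And>j. s < j \<Longrightarrow> flip_prob e' j = q" and q: "q \<le> 1"
    and uv: "v < u" "u < 2 ^ n" "v < 2 ^ n"
    and i: "s \<le> i" "i < n - 1" "bit u i \<noteq> bit v i"
  shows "p * (1 - p) ^ (2 * n) \<le> less_prob S e n u v \<and> less_prob S e' n u v \<le> 2 * real n * q \<or>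
         p\<^sup>2 \<le> less_prob S e n u v \<and> less_prob S e' n u v \<le> 4 * real n * q\<^sup>2"
proof -
  obtain m where n: "n = Suc m" using i by (cases n) auto
  have p0: "0 \<le> p" using flip[of 0] by (auto simp: flip_prob_def)
  have q0: "0 \<le> q" using flip'[of "Suc s"] by (auto simp: flip_prob_def)
  note rec = less_prob_Suc[OF flip[symmetric] p, of S m u v]
  have sm: "s \<le> m" using i n by simp
  have rec': "less_prob S e' n u v =
    (if bit u m = bit v m then (q\<^sup>2 + (1 - q)\<^sup>2) * less_prob S e' m u v + q * (1 - q)
     else 2 * q * (1 - q) * less_prob S e' m u v + (if bit v m then (1 - q)\<^sup>2 else q\<^sup>2))"
    unfolding n using sm q by (intro less_prob_Suc) (auto simp: flip')
  have tb: "take_bit n v < take_bit n u" using uv by (simp add: take_bit_nat_eq_self_iff[THEN iffD2])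
  have up: "less_prob S e' n u v \<le> 2 * real n * q"
  proof -
    have "less_prob S e' n u v \<le> 2 * real (n - s) * q"
      using flip' q tb i by (intro less_prob_le_one_flip) auto
    also have "\<dots> \<le> 2 * real n * q" using q0 by (intro mult_right_mono) auto
    finally show ?thesis .
  qed
  from tb[unfolded n] show ?thesis
  proof (cases rule: take_bit_Suc_less_cases)
    case 1
    \<comment> \<open>Equal top bits: flipping exactly the one of \<open>u\<close> or exactly the
      one of \<open>v\<close>, as their value dictates, already causes the error.\<close>
    have "(1 - p) ^ (2 * n) \<le> (1 - p) ^ 1"
      using p p0 n by (intro power_decreasing) auto
    then have "p * (1 - p) ^ (2 * n) \<le> p * (1 - p)" using p0 by (intro mult_left_mono) auto
    also have "\<dots> \<le> less_prob S e n u v" using 1 by (simp add: n rec less_prob_bounds)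
    finally show ?thesis using up by blast
  next
    case 2
    \<comment> \<open>Position \<open>i\<close> lies below the top bit, so the remaining bits differ
      too.\<close>
    have "take_bit m u \<noteq> take_bit m v"
      using i n by (metis bit_take_bit_iff diff_Suc_1)
    then consider "take_bit m u < take_bit m v" | "take_bit m v < take_bit m u" by linarith
    then show ?thesis
    proof cases
      case 1
      \<comment> \<open>The lower bits point the other way: one top flip makes the top bits tie, and
        reading the rest without flips yields the error.\<close>
      have "p * (1 - p) ^ (2 * n) = p * (1 - p)\<^sup>2 * (1 - p) ^ (2 * m)"
        by (simp add: n power2_eq_square)
      also have "\<dots> \<le> p * (1 - p)\<^sup>2 * less_prob S e m u v"
        using p0 less_prob_ge_no_flip[OF flip p 1] by (intro mult_left_mono) auto
      also have "\<dots> \<le> 2 * p * (1 - p) * less_prob S e m u v"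
      proof (rule mult_right_mono)
        have "p * (1 - p) * (1 - p) \<le> p * (1 - p) * 2" using p p0 by (intro mult_left_mono) auto
        then show "p * (1 - p)\<^sup>2 \<le> 2 * p * (1 - p)" by (simp add: power2_eq_square algebra_simps)
      qed (simp add: less_prob_bounds)
      also have "\<dots> \<le> less_prob S e n u v" using 2 by (simp add: n rec)
      finally show ?thesis using up by blast
    next
      \<comment> \<open>The lower bits point the same way: an error needs either both top flips or
        one top flip and an error below, which takes another flip. Both are of order
        \<open>q\<^sup>2\<close>.\<close>
      case 3: 2
      have "less_prob S e' m u v \<le> 2 * real (m - s) * q"
        using flip' q 3 i n by (intro less_prob_le_one_flip) auto
      also have "\<dots> \<le> 2 * real m * q" using q0 by (intro mult_right_mono) auto
      finally have "2 * q * less_prob S e' m u v \<le> 2 * q * (2 * real m * q)"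
        using q0 by (intro mult_left_mono) auto
      moreover have "2 * q * (1 - q) * less_prob S e' m u v \<le> 2 * q * less_prob S e' m u v"
        using q0 q by (intro mult_right_mono) (auto simp: less_prob_bounds mult_left_le)
      moreover have "less_prob S e' n u v = 2 * q * (1 - q) * less_prob S e' m u v + q\<^sup>2"
        using 2 by (simp add: rec')
      moreover have "4 * real n * q\<^sup>2 = 2 * q * (2 * real m * q) + 4 * q\<^sup>2"
        by (simp add: n power2_eq_square algebra_simps)
      moreover have "0 \<le> q\<^sup>2" by simp
      ultimately have "less_prob S e' n u v \<le> 4 * real n * q\<^sup>2" by linarith
      moreover have "p\<^sup>2 \<le> less_prob S e n u v"
        using 2 p p0 by (simp add: n rec less_prob_bounds)
      ultimately show ?thesis by blast
    qed
  qed
qed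

subsection \<open>Quicksort\<close>

lemma measure_bind_pmf_expectation:
  "measure_pmf.prob (bind_pmf M f) A = measure_pmf.expectation M (\<lambda>x. measure_pmf.prob (f x) A)"
proof -
  have "ennreal (measure_pmf.prob (bind_pmf M f) A) = (\<integral>\<^sup>+x. ennreal (measure_pmf.prob (f x) A) \<partial>M)"
    by (simp flip: measure_pmf.emeasure_eq_measure)
  also have "\<dots> = ennreal (measure_pmf.expectation M (\<lambda>x. measure_pmf.prob (f x) A))"
    by (intro nn_integral_eq_integral measure_pmf.integrable_const_bound[where B = 1]) auto
  finally show ?thesis by simp
qed

lemma measure_bind_bool_pmf:
  "measure_pmf.prob (bind_pmf M f) A =
     pmf M True * measure_pmf.prob (f True) A + (1 - pmf M True) * measure_pmf.prob (f False) A"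
proof -
  have "pmf M True + pmf M False = 1"
    using sum_pmf_eq_1[of UNIV M, OF finite subset_UNIV] by (simp add: UNIV_bool)
  then have "pmf M False = 1 - pmf M True" by linarith
  then show ?thesis
    by (simp add: measure_bind_pmf_expectation integral_measure_pmf[of UNIV] UNIV_bool)
qed

lemma set_pmf_partition:
  "lr \<in> set_pmf (partition_pmf e n C p xs) \<Longrightarrow> mset (fst lr) + mset (snd lr) = mset xs"
  by (induction xs arbitrary: lr) (auto split: if_splits)

lemma set_pmf_qs_fuel: "ys \<in> set_pmf (qs_fuel e n C f xs) \<Longrightarrow> mset ys = mset xs"
proof (induction f arbitrary: xs ys)
  case (Suc f)
  show ?case
  proof (cases "xs = []")
    case False
    with Suc.prems obtain i lr l r where i: "i < length xs"
      and lr: "lr \<in> set_pmf (partition_pmf e n C (xs ! i) (take i xs @ drop (Suc i) xs))"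
      and l: "l \<in> set_pmf (qs_fuel e n C f (fst lr))" and r: "r \<in> set_pmf (qs_fuel e n C f (snd lr))"
      and ys: "ys = l @ xs ! i # r"
      by (auto simp: set_pmf_of_set)
    have "mset ys = add_mset (xs ! i) (mset (fst lr) + mset (snd lr))"
      using Suc.IH[OF l] Suc.IH[OF r] ys by simp
    also have "\<dots> = mset (take i xs @ xs ! i # drop (Suc i) xs)"
      using set_pmf_partition[OF lr] by simp
    finally show ?thesis using i by (simp flip: id_take_nth_drop)
  qed (use Suc.prems in simp)
qed simp

text \<open>Comparisons with the pivot use independent reads, so the entries are placed
  independently; for an entry outside \<open>A\<close> and \<open>B\<close> the weights of its two
  placements add up to 1.\<close>

lemma prob_partition:
  assumes "distinct xs" "A \<inter> B = {}" "A \<union> B \<subseteq> set xs"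
  shows "measure_pmf.prob (partition_pmf e n C p xs) {lr. A \<subseteq> set (fst lr) \<and> B \<subseteq> set (snd lr)} =
    (\<Prod>a\<in>A. less_prob False e n (C ! a) (C ! p)) * (\<Prod>b\<in>B. 1 - less_prob False e n (C ! b) (C ! p))"
  using assms
proof (induction xs arbitrary: A B)
  case (Cons x xs)
  let ?P = "partition_pmf e n C p xs"
  let ?E = "\<lambda>A B. {lr. A \<subseteq> set (fst lr) \<and> B \<subseteq> set (snd lr)}"
  let ?l = "\<lambda>x. less_prob False e n (C ! x) (C ! p)"
  have fin: "finite A" "finite B" using Cons.prems by (auto intro: finite_subset)
  have supp: "set (fst lr) \<union> set (snd lr) = set xs" if "lr \<in> set_pmf ?P" for lr
    using set_pmf_partition[OF that] by (metis set_mset_mset set_mset_union)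
  have xs: "x \<notin> set xs" "distinct xs" using Cons.prems by auto
  have step: "measure_pmf.prob (partition_pmf e n C p (x # xs)) (?E A B) =
    ?l x * measure_pmf.prob ?P {lr. A \<subseteq> insert x (set (fst lr)) \<and> B \<subseteq> set (snd lr)} +
    (1 - ?l x) * measure_pmf.prob ?P {lr. A \<subseteq> set (fst lr) \<and> B \<subseteq> insert x (set (snd lr))}"
    by (simp add: measure_bind_bool_pmf pmf_inexact_less_True flip: map_pmf_def)
  have null: "measure_pmf.prob ?P {lr. Q lr} = 0" if "\<And>lr. lr \<in> set_pmf ?P \<Longrightarrow> \<not> Q lr" for Q
    using that by (auto simp: measure_pmf_zero_iff)
  consider "x \<in> A" | "x \<in> B" | "x \<notin> A" "x \<notin> B" by blast
  then show ?case
  proof cases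
    case 1
    have "measure_pmf.prob ?P {lr. A \<subseteq> set (fst lr) \<and> B \<subseteq> insert x (set (snd lr))} = 0"
      using 1 xs supp by (intro null) blast
    moreover have "{lr. A \<subseteq> insert x (set (fst lr)) \<and> B \<subseteq> set (snd lr)} = ?E (A - {x}) B"
      by (auto simp: subset_insert_iff)
    moreover have "measure_pmf.prob ?P (?E (A - {x}) B) =
        (\<Prod>a\<in>A - {x}. ?l a) * (\<Prod>b\<in>B. 1 - ?l b)"
      using Cons.prems 1 by (intro Cons.IH) auto
    ultimately show ?thesis
      unfolding step using 1 fin by (simp add: prod.remove[of A x])
  next
    case 2
    have "measure_pmf.prob ?P {lr. A \<subseteq> insert x (set (fst lr)) \<and> B \<subseteq> set (snd lr)} = 0"
      using 2 xs supp by (intro null) blast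
    moreover have "{lr. A \<subseteq> set (fst lr) \<and> B \<subseteq> insert x (set (snd lr))} = ?E A (B - {x})"
      by (auto simp: subset_insert_iff)
    moreover have "measure_pmf.prob ?P (?E A (B - {x})) =
        (\<Prod>a\<in>A. ?l a) * (\<Prod>b\<in>B - {x}. 1 - ?l b)"
      using Cons.prems 2 by (intro Cons.IH) auto
    ultimately show ?thesis
      unfolding step using 2 fin by (simp add: prod.remove[of B x])
  next
    case 3
    have "measure_pmf.prob ?P (?E A B) = (\<Prod>a\<in>A. ?l a) * (\<Prod>b\<in>B. 1 - ?l b)"
      using Cons.prems 3 by (intro Cons.IH) auto
    then show ?thesis
      unfolding step using 3 by (simp add: subset_insert algebra_simps)
  qed
qed simp

section \<open>The order of two entries in the output\<close>

definition precedes :: "'a \<Rightarrow> 'a \<Rightarrow> 'a list \<Rightarrow> bool" where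
  "precedes y z out \<longleftrightarrow> filter (\<lambda>i. i = y \<or> i = z) out = [y, z]"

text \<open>The probability that partitioning by \<open>p\<close> settles the order as
  \<open>y\<close> before \<open>z\<close>. The pivot sits between the two parts, so a factor
  becomes 1 if \<open>p\<close> is itself \<open>y\<close> or \<open>z\<close>.\<close>

definition sep_prob :: "(nat \<Rightarrow> real) \<Rightarrow> nat \<Rightarrow> nat list \<Rightarrow> nat \<Rightarrow> nat \<Rightarrow> nat \<Rightarrow> real" where
  "sep_prob e n C y z p =
    (if p = y then 1 else less_prob False e n (C ! y) (C ! p)) *
    (if p = z then 1 else 1 - less_prob False e n (C ! z) (C ! p))"

lemma sep_prob_nonneg: "0 \<le> sep_prob e n C y z p"
  by (simp add: sep_prob_def less_prob_bounds)

lemma filter_pair_singleton: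
  assumes "distinct l" "y \<in> set l" "z \<notin> set l"
  shows "filter (\<lambda>i. i = y \<or> i = z) l = [y]"
  using assms
proof (induction l)
  case (Cons x l)
  then show ?case by (cases "x = y") (auto simp: filter_empty_conv)
qed simp

text \<open>Applied with \<open>S\<close> the event that the pivot separates the pair as asked,
  \<open>g\<close> the probability of the order given the partition, and \<open>c\<close> a bound
  for the recursive calls.\<close>

lemma expectation_between_indicator:
  assumes "\<And>x. x \<in> set_pmf M \<Longrightarrow> indicator S x \<le> g x \<and> g x \<le> indicator S x + c"
  shows "measure_pmf.prob M S \<le> measure_pmf.expectation M g"
    and "measure_pmf.expectation M g \<le> measure_pmf.prob M S + c"
proof -
  have int: "integrable M g"
  proof (rule measure_pmf.integrable_const_bound[where B = "1 + c"])
    show "AE x in M. norm (g x) \<le> 1 + c"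
    proof (rule AE_pmfI)
      fix x assume "x \<in> set_pmf M"
      with assms[OF this] show "norm (g x) \<le> 1 + c"
        by (cases "x \<in> S") auto
    qed
  qed simp
  have inti: "integrable M (indicator S :: _ \<Rightarrow> real)"
    by (rule measure_pmf.integrable_const_bound[where B = 1]) auto
  have "measure_pmf.expectation M (indicator S) \<le> measure_pmf.expectation M g"
    using assms by (intro integral_mono_AE int inti) (auto simp: AE_measure_pmf_iff)
  then show "measure_pmf.prob M S \<le> measure_pmf.expectation M g" by simp
  have "measure_pmf.expectation M g \<le> measure_pmf.expectation M (\<lambda>x. indicator S x + c)"
    using assms inti by (intro integral_mono_AE int) (auto simp: AE_measure_pmf_iff)
  also have "\<dots> = measure_pmf.prob M S + c"
    using inti by (subst Bochner_Integration.integral_add) auto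
  finally show "measure_pmf.expectation M g \<le> measure_pmf.prob M S + c" .
qed

lemma precedes_append_Cons_iff:
  assumes "distinct (l @ p # r)" "y \<noteq> z" "y \<in> set (l @ p # r)" "z \<in> set (l @ p # r)"
  shows "precedes y z (l @ p # r) \<longleftrightarrow>
    {y} - {p} \<subseteq> set l \<and> {z} - {p} \<subseteq> set r \<or>
    y \<in> set l \<and> z \<in> set l \<and> precedes y z l \<or>
    y \<in> set r \<and> z \<in> set r \<and> precedes y z r"
proof -
  have sing: "filter (\<lambda>i. i = a \<or> i = b) m = [a]" "filter (\<lambda>i. i = b \<or> i = a) m = [a]"
    if "distinct m" "a \<in> set m" "b \<notin> set m" for a b and m :: "'a list"
    using filter_pair_singleton[OF that] by (simp_all add: disj_commute)
  have none: "filter (\<lambda>i. i = y \<or> i = z) m = []" if "y \<notin> set m" "z \<notin> set m" for m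
    using that by (auto simp: filter_empty_conv)
  show ?thesis
    using assms unfolding precedes_def
    by (cases "y \<in> set l"; cases "z \<in> set l"; cases "y \<in> set r"; cases "z \<in> set r"; cases "p = y"; cases "p = z")
       (simp_all add: sing none, (auto simp: sing none)?)
qed

text \<open>A separating pivot fixes the order for good: the right way contributes 1, the wrong way
  0. Otherwise both entries enter the same recursive call, which contributes at most
  \<open>c\<close>.\<close>

lemma pivot_step_bounds:
  fixes e n C
  assumes dist: "distinct (p # ys)" and yz: "y \<noteq> z" "y \<in> set (p # ys)" "z \<in> set (p # ys)"
    and c: "0 \<le> c"
    and IH: "\<And>zs. distinct zs \<Longrightarrow> set zs \<subseteq> set ys \<Longrightarrow> length zs \<le> length ys \<Longrightarrow> y \<in> set zs \<Longrightarrow> z \<in> set zs \<Longrightarrow>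
               measure_pmf.prob (qs_fuel e n C f zs) {out. precedes y z out} \<le> c"
  defines "X \<equiv> measure_pmf.prob (bind_pmf (partition_pmf e n C p ys) (\<lambda>lr.
      bind_pmf (qs_fuel e n C f (fst lr)) (\<lambda>l.
      bind_pmf (qs_fuel e n C f (snd lr)) (\<lambda>r.
      return_pmf (l @ p # r))))) {out. precedes y z out}"
  shows "sep_prob e n C y z p \<le> X" and "X \<le> sep_prob e n C y z p + c"
proof -
  let ?M = "partition_pmf e n C p ys"
  let ?q = "qs_fuel e n C f"
  let ?P = "{out. precedes y z out}"
  define S where "S = {lr :: nat list \<times> nat list. {y} - {p} \<subseteq> set (fst lr) \<and> {z} - {p} \<subseteq> set (snd lr)}"
  define g where "g lr = measure_pmf.prob (bind_pmf (?q (fst lr)) (\<lambda>l. bind_pmf (?q (snd lr)) (\<lambda>r. return_pmf (l @ p # r)))) ?P" for lr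
  have "measure_pmf.prob ?M S =
      (\<Prod>a\<in>{y} - {p}. less_prob False e n (C ! a) (C ! p)) *
      (\<Prod>b\<in>{z} - {p}. 1 - less_prob False e n (C ! b) (C ! p))"
    unfolding S_def using dist yz by (intro prob_partition) auto
  then have S: "measure_pmf.prob ?M S = sep_prob e n C y z p"
    by (cases "p = y"; cases "p = z") (auto simp: sep_prob_def)
  have X: "X = measure_pmf.expectation ?M g"
    unfolding X_def g_def by (rule measure_bind_pmf_expectation)
  have "indicator S lr \<le> g lr \<and> g lr \<le> indicator S lr + c" if "lr \<in> set_pmf ?M" for lr
  proof -
    let ?R = "pair_pmf (?q (fst lr)) (?q (snd lr))"
    have ms: "mset (fst lr) + mset (snd lr) = mset ys" by (rule set_pmf_partition[OF that])
    have dlr: "distinct (fst lr @ snd lr)" "set (fst lr) \<union> set (snd lr) = set ys"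
      using ms dist mset_eq_imp_distinct_iff[of "fst lr @ snd lr" ys] mset_eq_setD[of "fst lr @ snd lr" ys]
      by auto
    have len: "length (fst lr) \<le> length ys" "length (snd lr) \<le> length ys"
      using arg_cong[OF ms, of size] by auto
    have supp: "precedes y z (l @ p # r) \<longleftrightarrow> lr \<in> S \<or>
        y \<in> set (fst lr) \<and> z \<in> set (fst lr) \<and> precedes y z l \<or>
        y \<in> set (snd lr) \<and> z \<in> set (snd lr) \<and> precedes y z r"
      if "(l, r) \<in> set_pmf ?R" for l r
    proof -
      have m: "mset l = mset (fst lr)" "mset r = mset (snd lr)"
        using that by (auto dest: set_pmf_qs_fuel)
      have sets: "set l = set (fst lr)" "set r = set (snd lr)"
        using m by (auto dest: mset_eq_setD)
      moreover have "distinct (l @ p # r)"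
        using m[THEN mset_eq_imp_distinct_iff] dlr dist sets by auto
      ultimately show ?thesis
        using yz dlr(2) by (subst precedes_append_Cons_iff) (auto simp: S_def)
    qed
    have g: "g lr = measure_pmf.prob ?R {(l, r). precedes y z (l @ p # r)}"
    proof -
      have "bind_pmf (?q (fst lr)) (\<lambda>l. bind_pmf (?q (snd lr)) (\<lambda>r. return_pmf (l @ p # r))) =
          map_pmf (\<lambda>(l, r). l @ p # r) ?R"
        by (simp add: map_pmf_def pair_pmf_def bind_assoc_pmf bind_return_pmf)
      then show ?thesis by (simp add: g_def vimage_def case_prod_unfold)
    qed
    have g01: "0 \<le> g lr" "g lr \<le> 1" by (simp_all add: g_def)
    show ?thesis
    proof (cases "lr \<in> S")
      case True
      then have "g lr = 1" unfolding g using supp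
        by (subst measure_pmf.prob_eq_1) (auto simp: AE_measure_pmf_iff)
      with True c show ?thesis by simp
    next
      case False
      have "g lr \<le> c"
      proof -
        consider (l) "y \<in> set (fst lr)" "z \<in> set (fst lr)" | (r) "y \<in> set (snd lr)" "z \<in> set (snd lr)"
          | (n) "\<not> (y \<in> set (fst lr) \<and> z \<in> set (fst lr))" "\<not> (y \<in> set (snd lr) \<and> z \<in> set (snd lr))"
          by blast
        then show ?thesis
        proof cases
          case l
          with dlr have nr: "y \<notin> set (snd lr)" by auto
          have "g lr \<le> measure_pmf.prob ?R (fst -` ?P)"
            unfolding g using supp False nr
            by (intro measure_pmf.finite_measure_mono_AE) (auto simp: AE_measure_pmf_iff)
          also have "\<dots> = measure_pmf.prob (?q (fst lr)) ?P"
            by (simp only: map_fst_pair_pmf flip: measure_map_pmf)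
          also have "\<dots> \<le> c" using l dlr len by (intro IH) auto
          finally show ?thesis .
        next
          case r
          with dlr have nr: "y \<notin> set (fst lr)" by auto
          have "g lr \<le> measure_pmf.prob ?R (snd -` ?P)"
            unfolding g using supp False nr
            by (intro measure_pmf.finite_measure_mono_AE) (auto simp: AE_measure_pmf_iff)
          also have "\<dots> = measure_pmf.prob (?q (snd lr)) ?P"
            by (simp only: map_snd_pair_pmf flip: measure_map_pmf)
          also have "\<dots> \<le> c" using r dlr len by (intro IH) auto
          finally show ?thesis .
        next
          case n
          then have "g lr = 0" unfolding g using supp False
            by (subst measure_pmf_zero_iff) auto
          with c show ?thesis by simp
        qed
      qed
      with False g01 show ?thesis by simp
    qed
  qed
  from expectation_between_indicator[of ?M S g c, OF this]
  show "sep_prob e n C y z p \<le> X" and "X \<le> sep_prob e n C y z p + c"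
    by (simp_all add: X S)
qed

section \<open>Summing over the choice of the pivot\<close>

lemma prob_qs_fuel_Suc:
  assumes "xs \<noteq> []"
  shows "measure_pmf.prob (qs_fuel e n C (Suc f) xs) P = (\<Sum>i<length xs.
    measure_pmf.prob (bind_pmf (partition_pmf e n C (xs ! i) (take i xs @ drop (Suc i) xs)) (\<lambda>lr.
      bind_pmf (qs_fuel e n C f (fst lr)) (\<lambda>l.
      bind_pmf (qs_fuel e n C f (snd lr)) (\<lambda>r.
      return_pmf (l @ xs ! i # r))))) P) / real (length xs)"
  using assms
  by (simp add: measure_bind_pmf_expectation[of "pmf_of_set _"] integral_pmf_of_set lessThan_atLeast0)

lemma distinct_remove_nth:
  assumes "distinct xs" "i < length xs"
  shows "distinct (xs ! i # take i xs @ drop (Suc i) xs)"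
    and "set (xs ! i # take i xs @ drop (Suc i) xs) = set xs"
proof -
  have "mset (xs ! i # take i xs @ drop (Suc i) xs) = mset (take i xs @ xs ! i # drop (Suc i) xs)"
    by simp
  also have "\<dots> = mset xs" using assms by (simp only: id_take_nth_drop[symmetric])
  finally have "mset (xs ! i # take i xs @ drop (Suc i) xs) = mset xs" .
  from mset_eq_imp_distinct_iff[OF this] mset_eq_setD[OF this] assms(1)
  show "distinct (xs ! i # take i xs @ drop (Suc i) xs)"
    and "set (xs ! i # take i xs @ drop (Suc i) xs) = set xs" by blast+
qed

text \<open>Every first pivot contributes its own weight plus, by induction, at most the weights of
  the remaining entries. This total is the same for all pivots, so averaging loses nothing.\<close>

lemma prob_precedes_le:
  assumes "distinct xs" "length xs \<le> f" "y \<noteq> z" "y \<in> set xs" "z \<in> set xs"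
  shows "measure_pmf.prob (qs_fuel e n C f xs) {out. precedes y z out} \<le>
    (\<Sum>x\<in>set xs. sep_prob e n C y z x)"
  using assms
proof (induction f arbitrary: xs)
  case (Suc f)
  let ?w = "sep_prob e n C y z"
  have ne: "xs \<noteq> []" using Suc.prems by auto
  have "measure_pmf.prob (qs_fuel e n C (Suc f) xs) {out. precedes y z out} \<le>
      (\<Sum>i<length xs. \<Sum>x\<in>set xs. ?w x) / real (length xs)"
    unfolding prob_qs_fuel_Suc[OF ne]
  proof (intro divide_right_mono sum_mono)
    fix i assume "i \<in> {..<length xs}"
    then have i: "i < length xs" by simp
    let ?p = "xs ! i" and ?ys = "take i xs @ drop (Suc i) xs"
    note rem = distinct_remove_nth[OF Suc.prems(1) i]
    have "measure_pmf.prob (bind_pmf (partition_pmf e n C ?p ?ys) (\<lambda>lr.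
        bind_pmf (qs_fuel e n C f (fst lr)) (\<lambda>l.
        bind_pmf (qs_fuel e n C f (snd lr)) (\<lambda>r.
        return_pmf (l @ ?p # r))))) {out. precedes y z out} \<le> ?w ?p + (\<Sum>x\<in>set ?ys. ?w x)"
    proof (rule pivot_step_bounds(2))
      fix zs assume zs: "distinct zs" "set zs \<subseteq> set ?ys" "length zs \<le> length ?ys" "y \<in> set zs" "z \<in> set zs"
      have "length zs \<le> f" using zs(3) i Suc.prems(2) by simp
      with zs Suc.prems have "measure_pmf.prob (qs_fuel e n C f zs) {out. precedes y z out} \<le> (\<Sum>x\<in>set zs. ?w x)"
        by (intro Suc.IH) auto
      also have "\<dots> \<le> (\<Sum>x\<in>set ?ys. ?w x)"
        using zs by (intro sum_mono2) (auto simp: sep_prob_nonneg)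
      finally show "measure_pmf.prob (qs_fuel e n C f zs) {out. precedes y z out} \<le> (\<Sum>x\<in>set ?ys. ?w x)" .
    qed (use rem Suc.prems in \<open>auto intro!: sum_nonneg simp: sep_prob_nonneg\<close>)
    also have "\<dots> = (\<Sum>x\<in>set (?p # ?ys). ?w x)" using rem(1) by simp
    also have "\<dots> = (\<Sum>x\<in>set xs. ?w x)" by (simp only: rem)
    finally show "measure_pmf.prob (bind_pmf (partition_pmf e n C ?p ?ys) (\<lambda>lr.
        bind_pmf (qs_fuel e n C f (fst lr)) (\<lambda>l.
        bind_pmf (qs_fuel e n C f (snd lr)) (\<lambda>r.
        return_pmf (l @ ?p # r))))) {out. precedes y z out} \<le> (\<Sum>x\<in>set xs. ?w x)" .
  qed simp
  also have "\<dots> = (\<Sum>x\<in>set xs. ?w x)" using ne by simp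
  finally show ?case .
qed simp

text \<open>Only separations by the first pivot are counted; each entry is that pivot with
  probability \<open>1 / length xs\<close>.\<close>

lemma prob_precedes_ge:
  assumes "distinct xs" "0 < f" "y \<noteq> z" "y \<in> set xs" "z \<in> set xs"
  shows "(\<Sum>x\<in>set xs. sep_prob e n C y z x) / real (length xs) \<le>
    measure_pmf.prob (qs_fuel e n C f xs) {out. precedes y z out}"
proof -
  let ?w = "sep_prob e n C y z"
  have ne: "xs \<noteq> []" using assms by auto
  obtain f' where f: "f = Suc f'" using assms(2) by (cases f) auto
  have "(\<Sum>x\<in>set xs. ?w x) = (\<Sum>i<length xs. ?w (xs ! i))"
    using assms(1) by (intro sum.reindex_bij_betw[symmetric] bij_betw_nth) auto
  also have "\<dots> / real (length xs) \<le> measure_pmf.prob (qs_fuel e n C f xs) {out. precedes y z out}"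
    unfolding f prob_qs_fuel_Suc[OF ne]
  proof (intro divide_right_mono sum_mono)
    fix i assume "i \<in> {..<length xs}"
    then have i: "i < length xs" by simp
    show "?w (xs ! i) \<le> measure_pmf.prob (bind_pmf (partition_pmf e n C (xs ! i) (take i xs @ drop (Suc i) xs)) (\<lambda>lr.
        bind_pmf (qs_fuel e n C f' (fst lr)) (\<lambda>l.
        bind_pmf (qs_fuel e n C f' (snd lr)) (\<lambda>r.
        return_pmf (l @ xs ! i # r))))) {out. precedes y z out}"
      using distinct_remove_nth[OF assms(1) i] assms
      \<comment> \<open>The lower bound does not involve \<open>c\<close>, so the trivial bound 1 on
        the recursive calls will do.\<close>
      by (intro pivot_step_bounds(1)[where c = 1]) auto
  qed simp
  finally show ?thesis by simp
qed

text \<open>The value of the pivot decides which comparisons must err: one if the pivot belongs to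
  the pair (\<rho>), one beside a correct one if it lies outside the two values (\<gamma>\<rho>),
  both if it lies between them (\<open>\<rho>\<^sup>2\<close>). So \<kappa> stays below all
  three.\<close>

lemma sep_prob_ratio:
  assumes e: "\<And>j. 0 \<le> e j" "\<And>j. 0 \<le> e' j"
    and wrong: "\<And>S a b. a \<in> I \<Longrightarrow> b \<in> I \<Longrightarrow> C ! b < C ! a \<Longrightarrow>
      \<rho> * less_prob S e' n (C ! a) (C ! b) \<le> less_prob S e n (C ! a) (C ! b)"
    and correct: "\<And>S a b. a \<in> I \<Longrightarrow> b \<in> I \<Longrightarrow> C ! a < C ! b \<Longrightarrow>
      \<gamma> \<le> less_prob S e n (C ! a) (C ! b)"
    and inj: "inj_on ((!) C) I"
    and I: "y \<in> I" "z \<in> I" "p \<in> I" and zy: "C ! z < C ! y"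
    and \<rho>: "0 \<le> \<gamma>" "0 \<le> \<rho>" "\<kappa> \<le> \<rho>" "\<kappa> \<le> \<gamma> * \<rho>" "\<kappa> \<le> \<rho>\<^sup>2"
  shows "\<kappa> * sep_prob e' n C y z p \<le> sep_prob e n C y z p"
proof -
  let ?A = "less_prob False e n (C ! y) (C ! p)" and ?A' = "less_prob False e' n (C ! y) (C ! p)"
  let ?B = "less_prob True e n (C ! p) (C ! z)" and ?B' = "less_prob True e' n (C ! p) (C ! z)"
  have compl: "1 - less_prob False e n (C ! z) (C ! p) = ?B" "1 - less_prob False e' n (C ! z) (C ! p) = ?B'"
    using less_prob_compl[of e] less_prob_compl[of e'] e by simp_all
  have bds: "0 \<le> ?A" "0 \<le> ?B" "0 \<le> ?A'" "0 \<le> ?B'" "?A' \<le> 1" "?B' \<le> 1"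
    by (simp_all add: less_prob_bounds)
  have neq: "y \<noteq> z" using zy by auto
  consider "p = y" | "p = z" | "p \<noteq> y" "p \<noteq> z" by blast
  then show ?thesis
  proof cases
    case 1
    have "\<kappa> * ?B' \<le> \<rho> * ?B'" using \<rho> bds by (intro mult_right_mono) auto
    also have "\<dots> \<le> ?B" using wrong I zy 1 by simp
    finally show ?thesis using 1 neq by (simp add: sep_prob_def compl[unfolded 1])
  next
    case 2
    have "\<kappa> * ?A' \<le> \<rho> * ?A'" using \<rho> bds by (intro mult_right_mono) auto
    also have "\<dots> \<le> ?A" using wrong I zy 2 by simp
    finally show ?thesis using 2 neq by (simp add: sep_prob_def compl)
  next
    case 3
    then have "C ! p \<noteq> C ! y" "C ! p \<noteq> C ! z" using inj I by (auto dest: inj_onD)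
    then consider "C ! p < C ! z" "C ! p < C ! y" | "C ! z < C ! p" "C ! p < C ! y" | "C ! y < C ! p" "C ! z < C ! p"
      using zy by linarith
    then have "\<kappa> * (?A' * ?B') \<le> ?A * ?B"
    proof cases
      case 1
      have "\<kappa> * (?A' * ?B') \<le> \<gamma> * \<rho> * (?A' * 1)"
        using \<rho> bds by (intro mult_mono) auto
      also have "\<dots> = (\<rho> * ?A') * \<gamma>" by simp
      also have "\<dots> \<le> ?A * ?B"
        using \<rho> bds I 1 wrong correct by (intro mult_mono) auto
      finally show ?thesis .
    next
      case 2
      have "\<kappa> * (?A' * ?B') \<le> \<rho>\<^sup>2 * (?A' * ?B')"
        using \<rho> bds by (intro mult_right_mono) auto
      also have "\<dots> = (\<rho> * ?A') * (\<rho> * ?B')" by (simp add: power2_eq_square)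
      also have "\<dots> \<le> ?A * ?B"
        using \<rho> bds I 2 wrong by (intro mult_mono) auto
      finally show ?thesis .
    next
      case 3
      have "\<kappa> * (?A' * ?B') \<le> \<gamma> * \<rho> * (1 * ?B')"
        using \<rho> bds by (intro mult_mono) auto
      also have "\<dots> = \<gamma> * (\<rho> * ?B')" by simp
      also have "\<dots> \<le> ?A * ?B"
        using \<rho> bds I 3 wrong correct by (intro mult_mono) auto
      finally show ?thesis .
    qed
    with 3 show ?thesis by (simp add: sep_prob_def compl)
  qed
qed

section \<open>From pairs of entries to \<open>wkt\<close>\<close>

lemma wrong_order_iff_precedes:
  assumes "C ! a \<noteq> C ! b"
  obtains y z where "{y, z} = {a, b}" "C ! z < C ! y" "\<And>out. wrong_order C a b out \<longleftrightarrow> precedes y z out"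
proof (cases "C ! a < C ! b")
  case True
  show ?thesis
    by (rule that[of b a]) (use True in \<open>auto simp: wrong_order_def precedes_def disj_commute\<close>)
next
  case False
  show ?thesis
    by (rule that[of a b]) (use False assms in \<open>auto simp: wrong_order_def precedes_def\<close>)
qed

text \<open>Both sums carry the same weights, so the comparison is termwise. The loss of
  \<open>length C\<close> is the gap between \<open>prob_precedes_le\<close> for \<open>e'\<close>
  and \<open>prob_precedes_ge\<close> for \<open>e\<close>.\<close>

lemma wkt_ratio:
  assumes inj: "inj_on ((!) C) {..<length C}" and "0 \<le> \<kappa>"
    and ratio: "\<And>y z p. y < length C \<Longrightarrow> z < length C \<Longrightarrow> p < length C \<Longrightarrow> C ! z < C ! y \<Longrightarrow>
      \<kappa> * sep_prob e' n C y z p \<le> sep_prob e n C y z p"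
  shows "\<kappa> / real (length C) * wkt e' n C \<le> wkt e n C"
proof -
  let ?N = "length C"
  have "\<kappa> / real ?N * measure_pmf.prob (quicksort e' n C) {out. wrong_order C a b out} \<le>
      measure_pmf.prob (quicksort e n C) {out. wrong_order C a b out}"
    if ab: "a < ?N" "b < ?N" "a < b" for a b
  proof -
    have "C ! a \<noteq> C ! b" using inj_onD[OF inj, of a b] ab by auto
    then obtain y z where yz: "{y, z} = {a, b}" "C ! z < C ! y"
      "\<And>out. wrong_order C a b out \<longleftrightarrow> precedes y z out" by (rule wrong_order_iff_precedes) blast
    have mem: "y < ?N" "z < ?N" "y \<noteq> z" using yz ab by (auto simp: doubleton_eq_iff)
    have "\<kappa> / real ?N * measure_pmf.prob (quicksort e' n C) {out. precedes y z out} \<le>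
        \<kappa> / real ?N * (\<Sum>p\<in>set [0..<?N]. sep_prob e' n C y z p)"
      unfolding quicksort_def using mem assms(2) by (intro mult_left_mono prob_precedes_le) auto
    also have "\<dots> = (\<Sum>p\<in>set [0..<?N]. \<kappa> * sep_prob e' n C y z p) / real ?N"
      by (simp add: sum_distrib_left sum_divide_distrib)
    also have "\<dots> \<le> (\<Sum>p\<in>set [0..<?N]. sep_prob e n C y z p) / real ?N"
      using ratio mem yz(2) by (intro divide_right_mono sum_mono) auto
    also have "\<dots> \<le> measure_pmf.prob (quicksort e n C) {out. precedes y z out}"
    proof -
      have "C \<noteq> []" using mem by auto
      then show ?thesis
        unfolding quicksort_def using mem prob_precedes_ge[of "[0..<?N]" ?N y z e n C] by simp
    qed
    finally show ?thesis by (simp add: yz(3))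
  qed
  note pair = this
  show ?thesis
    unfolding wkt_def sum_distrib_left
  proof (intro sum_mono)
    fix a b assume "a \<in> {..<?N}" "b \<in> {a<..<?N}"
    then have "\<kappa> / real ?N * measure_pmf.prob (quicksort e' n C) {out. wrong_order C a b out} \<le>
      measure_pmf.prob (quicksort e n C) {out. wrong_order C a b out}" by (intro pair) auto
    from mult_left_mono[OF this, of "\<bar>real (C ! a) - real (C ! b)\<bar>"]
    show "\<kappa> / real ?N * (\<bar>real (C ! a) - real (C ! b)\<bar> *
        measure_pmf.prob (quicksort e' n C) {out. wrong_order C a b out})
      \<le> \<bar>real (C ! a) - real (C ! b)\<bar> * measure_pmf.prob (quicksort e n C) {out. wrong_order C a b out}"
      by (simp add: mult_ac)
  qed
qed

text \<open>Division by 0 yields 0, so a vanishing denominator in \<open>is_bad\<close> would make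
  an input bad. One pair with a positive term excludes this.\<close>

lemma wkt_pos:
  assumes inj: "inj_on ((!) C) {..<length C}" and "2 \<le> length C"
    and e: "\<And>j. 0 \<le> e j" and n: "0 < n" "flip_prob e n < 1"
  shows "0 < wkt e n C"
proof -
  let ?N = "length C"
  let ?t = "\<lambda>a b. \<bar>real (C ! a) - real (C ! b)\<bar> *
      measure_pmf.prob (quicksort e n C) {out. wrong_order C a b out}"
  have "0 \<in> {..<?N}" "1 \<in> {..<?N}" using assms(2) by auto
  from inj_on_eq_iff[OF inj this] have ne: "C ! 0 \<noteq> C ! 1" by simp
  then obtain y z where yz: "{y, z} = {0, 1}" "C ! z < C ! y"
    "\<And>out. wrong_order C 0 1 out \<longleftrightarrow> precedes y z out" by (rule wrong_order_iff_precedes) blast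
  have mem: "y < ?N" "z < ?N" "y \<noteq> z" using yz assms(2) by (auto simp: doubleton_eq_iff)
  \<comment> \<open>With \<open>y\<close> as pivot a single comparison factor is left.\<close>
  have "0 < sep_prob e n C y z y"
    using mem less_prob_compl[of e False n "C ! z" "C ! y", OF e] less_prob_pos[OF n, of True]
    by (simp add: sep_prob_def)
  also have "\<dots> \<le> (\<Sum>p\<in>set [0..<?N]. sep_prob e n C y z p)"
    using mem by (intro member_le_sum) (auto simp: sep_prob_nonneg)
  finally have "0 < (\<Sum>p\<in>set [0..<?N]. sep_prob e n C y z p) / real (length [0..<?N])"
    using mem by (intro divide_pos_pos) auto
  also have "\<dots> \<le> measure_pmf.prob (quicksort e n C) {out. precedes y z out}"
    unfolding quicksort_def using mem by (intro prob_precedes_ge) auto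
  finally have "0 < ?t 0 1" using ne by (simp add: yz(3)[simplified])
  also have "?t 0 1 \<le> (\<Sum>b\<in>{0<..<?N}. ?t 0 b)"
    using assms(2) by (intro member_le_sum) auto
  also have "\<dots> \<le> wkt e n C"
    unfolding wkt_def using assms(2)
    by (intro member_le_sum[of 0 "{..<?N}" "\<lambda>a. \<Sum>b\<in>{a<..<?N}. ?t a b"]) (auto intro!: sum_nonneg)
  finally show ?thesis .
qed

subsection \<open>Random inputs\<close>

text \<open>Positions count from 0. The most significant bit is left out: if it alone differs among
  the top \<open>m\<close> bits, one flip may suffice to err under \<open>e_t\<close> while
  \<open>e_o\<close> needs two. For \<open>m = 1\<close> the condition is vacuously true.\<close>

definition agree_mid :: "nat \<Rightarrow> nat \<Rightarrow> nat \<Rightarrow> nat \<Rightarrow> bool" where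
  "agree_mid n m u v \<longleftrightarrow> (\<forall>i. n - m \<le> i \<and> i < n - 1 \<longrightarrow> bit u i = bit v i)"

lemma finite_inputs: "finite (inputs n N)"
  using finite_lists_length_eq[of "{..<2 ^ n :: nat}" N] by (simp add: inputs_def conj_commute)

lemma inputs_nonempty: "inputs n N \<noteq> {}"
proof -
  have "replicate N 0 \<in> inputs n N" by (auto simp: inputs_def)
  then show ?thesis by blast
qed

lemma xor_less_exp_nat:
  fixes u v :: nat
  assumes "u < 2 ^ n" "v < 2 ^ n"
  shows "xor u v < 2 ^ n"
  using assms by (simp flip: take_bit_nat_eq_self_iff)

text \<open>XORing the \<open>m - 1\<close> bits in question of the entry at \<open>b\<close> with an arbitrary pattern is injective on
  the inputs whose entries at \<open>a\<close> and \<open>b\<close> agree there: the entry at \<open>a\<close> tells the pattern.\<close>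

lemma card_agree_mid_le:
  assumes m: "1 \<le> m" "m \<le> n" and ab: "a < N" "b < N" "a \<noteq> b"
  shows "card {C \<in> inputs n N. agree_mid n m (C ! a) (C ! b)} * 2 ^ (m - 1) \<le> card (inputs n N)"
proof -
  let ?A = "{C \<in> inputs n N. agree_mid n m (C ! a) (C ! b)}"
  let ?T = "{..<2 ^ (m - 1)} :: nat set"
  let ?g = "\<lambda>(C, t). C[b := xor (C ! b) (push_bit (n - m) t)]"
  have shift: "push_bit (n - m) t < 2 ^ n" if "t < 2 ^ (m - 1)" for t :: nat
  proof -
    have "push_bit (n - m) t < 2 ^ (m - 1) * 2 ^ (n - m)" using that by (simp add: push_bit_eq_mult)
    also have "\<dots> = 2 ^ (n - 1)" using m by (simp flip: power_add)
    also have "\<dots> \<le> 2 ^ n" by (simp add: power_increasing)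
    finally show ?thesis .
  qed
  have inj: "inj_on ?g (?A \<times> ?T)"
  proof (rule inj_onI, clarify)
    fix C t C' t'
    assume C: "C \<in> inputs n N" "agree_mid n m (C ! a) (C ! b)" and t: "t < 2 ^ (m - 1)"
      and C': "C' \<in> inputs n N" "agree_mid n m (C' ! a) (C' ! b)" and t': "t' < 2 ^ (m - 1)"
      and eq: "C[b := xor (C ! b) (push_bit (n - m) t)] = C'[b := xor (C' ! b) (push_bit (n - m) t')]"
    have len: "length C = N" "length C' = N" using C C' by (auto simp: inputs_def)
    have nth: "C ! j = C' ! j" if "j \<noteq> b" for j
      using arg_cong[OF eq, of "\<lambda>C. C ! j"] that by simp
    have xb: "xor (C ! b) (push_bit (n - m) t) = xor (C' ! b) (push_bit (n - m) t')"
      using arg_cong[OF eq, of "\<lambda>C. C ! b"] ab len by simp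
    have "t = t'"
    proof (rule bit_eqI)
      fix i
      show "bit t i = bit t' i"
      proof (cases "i < m - 1")
        case True
        then have i: "n - m \<le> n - m + i" "n - m + i < n - 1" using m by auto
        \<comment> \<open>Both equal the bit of the entry at \<open>a\<close>, which the update
          leaves alone.\<close>
        have "bit (C ! b) (n - m + i) = bit (C' ! b) (n - m + i)"
          using C(2) C'(2) i nth[of a] ab by (simp add: agree_mid_def)
        moreover have "bit (xor (C ! b) (push_bit (n - m) t)) (n - m + i) =
            bit (xor (C' ! b) (push_bit (n - m) t')) (n - m + i)" by (simp only: xb)
        ultimately show ?thesis by (auto simp: bit_xor_iff bit_push_bit_iff')
      next
        case False
        then show ?thesis
          using t t' bit_take_bit_iff[of "m - 1" t i] bit_take_bit_iff[of "m - 1" t' i]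
          by (simp add: take_bit_nat_eq_self_iff[THEN iffD2])
      qed
    qed
    moreover have "C ! b = C' ! b"
    proof -
      have cancel: "xor (xor x s) s = x" for x s :: nat by (simp add: xor.assoc)
      from xb \<open>t = t'\<close> show ?thesis by (metis cancel)
    qed
    with nth have "C ! j = C' ! j" for j by (cases "j = b") auto
    with len have "C = C'" by (simp add: list_eq_iff_nth_eq)
    ultimately show "C = C' \<and> t = t'" by simp
  qed
  have "?g ` (?A \<times> ?T) \<subseteq> inputs n N"
  proof clarify
    fix C t assume C: "C \<in> inputs n N" and t: "t < (2::nat) ^ (m - 1)"
    have "C ! b < 2 ^ n" using C ab by (auto simp: inputs_def subset_iff)
    then have "xor (C ! b) (push_bit (n - m) t) < 2 ^ n" using shift[OF t] by (rule xor_less_exp_nat)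
    then show "C[b := xor (C ! b) (push_bit (n - m) t)] \<in> inputs n N"
      using C set_update_subset_insert[of C b "xor (C ! b) (push_bit (n - m) t)"] by (auto simp: inputs_def)
  qed
  from card_inj_on_le[OF inj this finite_inputs]
  show ?thesis by (simp add: card_cartesian_product)
qed

text \<open>A union bound over at most \<open>N ^ 2\<close> ordered pairs; the factor 2 stems from
  comparing only \<open>m - 1\<close> bits.\<close>

lemma prob_some_agree_mid_le:
  assumes m: "1 \<le> m" "m \<le> n"
  shows "measure_pmf.prob (input_dist n N)
      {C. \<exists>a<N. \<exists>b<N. a \<noteq> b \<and> agree_mid n m (C ! a) (C ! b)} \<le> 2 * real N ^ 2 / 2 ^ m"
proof -
  let ?J = "{(a, b). a < N \<and> b < N \<and> a \<noteq> b}"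
  let ?A = "\<lambda>j. {C \<in> inputs n N. agree_mid n m (C ! fst j) (C ! snd j)}"
  have pos: "0 < card (inputs n N)" using finite_inputs inputs_nonempty by (simp add: card_gt_0_iff)
  have J: "?J \<subseteq> {..<N} \<times> {..<N}" by auto
  then have finJ: "finite ?J" by (rule finite_subset) auto
  have cardJ: "card ?J \<le> N ^ 2" using card_mono[OF _ J] by (simp add: power2_eq_square)
  have single: "real (card (?A j)) \<le> 2 * real (card (inputs n N)) / 2 ^ m" if "j \<in> ?J" for j
  proof -
    have "card (?A j) * 2 ^ (m - 1) \<le> card (inputs n N)"
      using that by (intro card_agree_mid_le m) auto
    then have "real (card (?A j)) * 2 ^ (m - 1) \<le> real (card (inputs n N))"
      using of_nat_mono[where 'a = real] by fastforce
    moreover have "(2::real) ^ m = 2 * 2 ^ (m - 1)" using m by (cases m) auto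
    ultimately show ?thesis by (simp add: field_simps)
  qed
  have "inputs n N \<inter> {C. \<exists>a<N. \<exists>b<N. a \<noteq> b \<and> agree_mid n m (C ! a) (C ! b)} = (\<Union>j\<in>?J. ?A j)"
    by fastforce
  then have "real (card (inputs n N \<inter> {C. \<exists>a<N. \<exists>b<N. a \<noteq> b \<and> agree_mid n m (C ! a) (C ! b)})) \<le>
      real (\<Sum>j\<in>?J. card (?A j))"
    using card_UN_le[OF finJ, of ?A] by (simp only: of_nat_le_iff)
  also have "\<dots> \<le> real (card ?J) * (2 * real (card (inputs n N)) / 2 ^ m)"
    unfolding of_nat_sum by (rule sum_bounded_above) (rule single)
  also have "\<dots> \<le> real (N ^ 2) * (2 * real (card (inputs n N)) / 2 ^ m)"
    using cardJ by (intro mult_right_mono) (auto simp del: of_nat_power)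
  finally show ?thesis
    using pos by (simp add: input_dist_def measure_pmf_of_set[OF inputs_nonempty finite_inputs] field_simps)
qed

subsection \<open>Bad inputs\<close>

text \<open>Let \<open>p\<close> be the flip probability. From
  \<open>n ^ 2 \<le> 2 ^ (n + 1)\<close> follows \<open>n * p \<le> 1\<close>, and
  \<open>1 - p \<ge> exp (- 2 * p)\<close> for \<open>p \<le> 1 / 2\<close>; together the power is
  at least \<open>exp (- 4 * n * p)\<close>.\<close>

lemma no_flip_prob_ge:
  assumes "1 \<le> n"
  shows "exp (- 4) \<le> (1 - 2 powr (- ((real n + 1) / 2))) ^ (2 * n)"
proof -
  define p where "p = 2 powr (- ((real n + 1) / 2))"
  have p0: "0 < p" by (simp add: p_def)
  have p2: "p\<^sup>2 = 1 / 2 ^ (n + 1)"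
    by (simp add: p_def power2_eq_square flip: powr_add)
       (simp add: powr_diff powr_minus_divide powr_realpow)
  have half: "p \<le> 1 / 2"
  proof -
    have "2 powr (- ((real n + 1) / 2)) \<le> 2 powr (- 1)" using assms by (intro powr_mono) auto
    then show ?thesis by (simp add: p_def powr_minus_divide)
  qed
  have sq: "n ^ 2 \<le> 2 ^ (n + 1)"
  proof (cases "n < 4")
    case True
    then have "n = 0 \<or> n = 1 \<or> n = 2 \<or> n = 3" by auto
    then show ?thesis by auto
  next
    case False
    then have "4 \<le> n" by simp
    then show ?thesis
    proof (induction n rule: dec_induct)
      case (step n)
      have "4 * n \<le> n * n" using step by (intro mult_right_mono) auto
      with step(1) have "Suc (n + n) \<le> n * n" by linarith
      then have "Suc n ^ 2 \<le> 2 * n ^ 2" by (simp add: power2_eq_square)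
      with step show ?case by simp
    qed simp
  qed
  have "(real n * p)\<^sup>2 = real (n ^ 2) / real (2 ^ (n + 1))" by (simp add: power_mult_distrib p2)
  also have "\<dots> \<le> 1" using sq by (simp del: of_nat_power add: of_nat_le_iff)
  finally have "\<bar>real n * p\<bar> \<le> 1" by (simp only: abs_square_le_1)
  then have np: "real n * p \<le> 1" by linarith
  have "p * p \<le> p * (1 / 2)" using p0 half by (intro mult_left_mono) auto
  then have "- 2 * p \<le> - p - 2 * p\<^sup>2" by (simp add: power2_eq_square)
  also have "\<dots> \<le> ln (1 - p)" using p0 half by (intro ln_one_minus_pos_lower_bound) auto
  finally have "- 2 * p \<le> ln (1 - p)" .
  then have le: "exp (- 2 * p) \<le> 1 - p" using half by (subst (asm) ln_ge_iff) auto
  have "exp (- 4) \<le> exp (real (2 * n) * (- 2 * p))" using np by simp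
  also have "\<dots> = exp (- 2 * p) ^ (2 * n)" by (rule exp_of_nat_mult)
  also have "\<dots> \<le> (1 - p) ^ (2 * n)" using le by (intro power_mono) auto
  finally show ?thesis by (simp add: p_def)
qed

lemma wkt_ratio_lower_bound:
  fixes k :: real
  assumes k: "1 \<le> k" and n: "1 \<le> n" and m: "real n / k = real m"
    and C: "C \<in> inputs n N" and N: "2 \<le> N"
    and dis: "\<And>a b. a < N \<Longrightarrow> b < N \<Longrightarrow> a \<noteq> b \<Longrightarrow> \<not> agree_mid n m (C ! a) (C ! b)"
  shows "exp (- 4) ^ 2 * 2 powr (real n * (k - 1) / 2) / (81 * real n ^ 4 * real N) \<le>
    wkt (e_o n) n C / wkt (e_t n k) n C"
proof -
  define p where "p = 2 powr (- ((real n + 1) / 2))"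
  define q where "q = 2 powr (- (real n * k / 2))"
  define Y where "Y = 2 powr (real n * (k - 1) / 2)"
  define \<gamma> :: real where "\<gamma> = exp (- 4)"
  \<comment> \<open>\<open>p / q\<close> is \<open>Y / sqrt 2\<close>, and \<open>9 * n ^ 2\<close>
    absorbs the union bound factors \<open>2 * n\<close> and \<open>4 * n\<close>. In \<kappa> only
    one factor \<open>Y\<close> is kept, so that \<open>\<rho>\<^sup>2 = \<kappa> * Y\<close> and
    \<kappa> is also below \<gamma>\<rho>.\<close>
  define \<rho> where "\<rho> = \<gamma> * Y / (9 * real n ^ 2)"
  define \<kappa> where "\<kappa> = \<gamma> ^ 2 * Y / (81 * real n ^ 4)"
  have lenC: "length C = N" and C2: "\<And>a. a < N \<Longrightarrow> C ! a < 2 ^ n"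
    using C by (auto simp: inputs_def subset_iff)
  have eo: "0 \<le> e_o n j" and et: "0 \<le> e_t n k j" for j using k by (auto simp: e_o_def e_t_def)
  have "real m \<le> real n" using k by (simp add: m[symmetric] divide_le_eq mult_le_cancel_left1)
  then have mn: "m \<le> n" by simp
  have "0 < real m" using k n by (simp add: m[symmetric])
  then have m1: "1 \<le> m" by simp
  have flip_o: "flip_prob (e_o n) j = p" for j by (simp add: flip_prob_def e_o_def p_def)
  have flip_t: "flip_prob (e_t n k) j = q" if "n - m < j" for j
  proof -
    have "real n - real n / k < real j" unfolding m using that mn by linarith
    then show ?thesis by (simp add: flip_prob_def e_t_def q_def)
  qed
  have p01: "0 < p" "p \<le> 1" unfolding p_def using powr_mono[of "- ((real n + 1) / 2)" 0 2] by auto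
  have "2 powr (- (real n * k / 2)) < 2 powr 0" using n k by (intro powr_less_mono) auto
  then have q01: "0 < q" "q < 1" by (auto simp: q_def)
  have Y1: "1 \<le> Y" unfolding Y_def using n k by (intro ge_one_powr_ge_zero) auto
  have \<gamma>01: "0 < \<gamma>" "\<gamma> \<le> 1" by (auto simp: \<gamma>_def)
  have n2: "1 \<le> real n ^ 2" using n by auto
  \<comment> \<open>The exponents satisfy
    \<open>- (n + 1) = - n * k + n * (k - 1) - 1\<close>.\<close>
  have p2: "p\<^sup>2 = q\<^sup>2 * Y\<^sup>2 / 2"
  proof -
    have "p\<^sup>2 * 2 = 2 powr (- (real n + 1)) * 2 powr 1"
      by (simp add: p_def power2_eq_square flip: powr_add) 
    also have "\<dots> = 2 powr (- real n)" by (simp add: powr_diff)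
    also have "\<dots> = (q * Y)\<^sup>2"
      by (simp add: q_def Y_def power2_eq_square flip: powr_add) (simp add: field_simps)
    finally show ?thesis by (simp add: power_mult_distrib)
  qed
  have pq: "q * Y / 2 \<le> p"
  proof (rule power2_le_imp_le)
    show "(q * Y / 2)\<^sup>2 \<le> p\<^sup>2" by (simp add: p2 power_mult_distrib power_divide)
  qed (use p01 in simp)
  have no_flip: "\<gamma> \<le> (1 - p) ^ (2 * n)" using no_flip_prob_ge[OF n] by (simp add: \<gamma>_def p_def)
  \<comment> \<open>Equal values agree in every bit, so \<open>dis\<close> also provides the
    distinctness of the entries.\<close>
  have inj: "inj_on ((!) C) {..<N}"
  proof (rule inj_onI, rule ccontr)
    fix a b assume "a \<in> {..<N}" "b \<in> {..<N}" "C ! a = C ! b" "a \<noteq> b"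
    with dis[of a b] show False by (simp add: agree_mid_def)
  qed
  have correct: "\<gamma> \<le> less_prob S (e_o n) n (C ! a) (C ! b)"
    if "a \<in> {..<N}" "b \<in> {..<N}" "C ! a < C ! b" for S a b
  proof -
    have "take_bit n (C ! a) < take_bit n (C ! b)"
      using that C2 by (simp add: take_bit_nat_eq_self_iff[THEN iffD2])
    from less_prob_ge_no_flip[OF flip_o p01(2) this] no_flip show ?thesis by (rule order_trans[rotated])
  qed
  have wrong: "\<rho> * less_prob S (e_t n k) n (C ! a) (C ! b) \<le> less_prob S (e_o n) n (C ! a) (C ! b)"
    if ab: "a \<in> {..<N}" "b \<in> {..<N}" "C ! b < C ! a" for S a b
  proof -
    have "\<not> agree_mid n m (C ! a) (C ! b)" using ab by (intro dis) auto
    then obtain i where i: "n - m \<le> i" "i < n - 1" "bit (C ! a) i \<noteq> bit (C ! b) i"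
      by (auto simp: agree_mid_def)
    have \<rho>0: "0 \<le> \<rho>" using \<gamma>01 Y1 by (simp add: \<rho>_def)
    have "p * (1 - p) ^ (2 * n) \<le> less_prob S (e_o n) n (C ! a) (C ! b) \<and>
          less_prob S (e_t n k) n (C ! a) (C ! b) \<le> 2 * real n * q \<or>
          p\<^sup>2 \<le> less_prob S (e_o n) n (C ! a) (C ! b) \<and>
          less_prob S (e_t n k) n (C ! a) (C ! b) \<le> 4 * real n * q\<^sup>2"
      using ab C2 q01 by (intro wrong_less_prob_cases[OF flip_o p01(2) flip_t _ _ _ _ i]) auto
    then show ?thesis
    proof (elim disjE conjE)
      assume L: "p * (1 - p) ^ (2 * n) \<le> less_prob S (e_o n) n (C ! a) (C ! b)"
        and U: "less_prob S (e_t n k) n (C ! a) (C ! b) \<le> 2 * real n * q"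
      have "\<rho> * less_prob S (e_t n k) n (C ! a) (C ! b) \<le> \<rho> * (2 * real n * q)"
        using U \<rho>0 by (rule mult_left_mono)
      also have "\<dots> = \<gamma> * (q * Y / 2) * (4 / (9 * real n))"
        using n by (simp add: \<rho>_def field_simps power2_eq_square)
      also have "\<dots> \<le> \<gamma> * (q * Y / 2) * 1"
        using n \<gamma>01 q01 Y1 by (intro mult_left_mono) auto
      also have "\<dots> \<le> (1 - p) ^ (2 * n) * p"
        using no_flip pq \<gamma>01 q01 Y1 by (simp only: mult_1_right, intro mult_mono) auto
      also have "\<dots> \<le> less_prob S (e_o n) n (C ! a) (C ! b)" using L by (simp add: mult.commute)
      finally show ?thesis .
    next
      assume L: "p\<^sup>2 \<le> less_prob S (e_o n) n (C ! a) (C ! b)"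
        and U: "less_prob S (e_t n k) n (C ! a) (C ! b) \<le> 4 * real n * q\<^sup>2"
      have "\<rho> * less_prob S (e_t n k) n (C ! a) (C ! b) \<le> \<rho> * (4 * real n * q\<^sup>2)"
        using U \<rho>0 by (rule mult_left_mono)
      also have "\<dots> = (q\<^sup>2 * Y) * (\<gamma> * (8 / (9 * real n)) / 2)"
        using n by (simp add: \<rho>_def field_simps power2_eq_square)
      \<comment> \<open>With two flips on either side the ratio is \<open>Y\<^sup>2 / 2\<close>; the
        second factor \<open>Y\<close> is only used as a number that is at least 1.\<close>
      also have "\<dots> \<le> (q\<^sup>2 * Y) * (Y / 2)"
      proof (intro mult_left_mono divide_right_mono)
        have "\<gamma> * (8 / (9 * real n)) \<le> 1 * 1" using n \<gamma>01 by (intro mult_mono) auto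
        then show "\<gamma> * (8 / (9 * real n)) \<le> Y" using Y1 by simp
      qed (use Y1 in auto)
      also have "\<dots> = p\<^sup>2" unfolding p2 by (simp add: power2_eq_square)
      also note L
      finally show ?thesis .
    qed
  qed
  have \<kappa>: "0 \<le> \<kappa>" "\<kappa> \<le> \<rho>" "\<kappa> \<le> \<gamma> * \<rho>" "\<kappa> \<le> \<rho>\<^sup>2"
  proof -
    show "0 \<le> \<kappa>" using Y1 by (simp add: \<kappa>_def)
    have 1: "\<kappa> = \<gamma> * \<rho> * (1 / (9 * real n ^ 2))"
      using n by (simp add: \<kappa>_def \<rho>_def field_simps power2_eq_square eval_nat_numeral)
    have \<rho>0: "0 \<le> \<rho>" using \<gamma>01 Y1 by (simp add: \<rho>_def)
    have "\<gamma> * \<rho> * (1 / (9 * real n ^ 2)) \<le> \<gamma> * \<rho> * 1"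
    proof (rule mult_left_mono)
      show "1 / (9 * real n ^ 2) \<le> 1"
        using n2 by (subst divide_le_eq_1_pos) linarith+
    qed (use \<rho>0 \<gamma>01 in simp)
    with 1 show 2: "\<kappa> \<le> \<gamma> * \<rho>" by simp
    also have "\<dots> \<le> 1 * \<rho>" using \<rho>0 \<gamma>01 by (intro mult_right_mono) auto
    finally show "\<kappa> \<le> \<rho>" by simp
    have "\<kappa> * 1 \<le> \<kappa> * Y" using Y1 \<open>0 \<le> \<kappa>\<close> by (intro mult_left_mono) auto
    also have "\<dots> = \<rho>\<^sup>2" by (simp add: \<kappa>_def \<rho>_def power2_eq_square eval_nat_numeral)
    finally show "\<kappa> \<le> \<rho>\<^sup>2" by simp
  qed
  have "\<kappa> / real (length C) * wkt (e_t n k) n C \<le> wkt (e_o n) n C"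
  proof (rule wkt_ratio)
    fix y z p assume "y < length C" "z < length C" "p < length C" "C ! z < C ! y"
    then show "\<kappa> * sep_prob (e_t n k) n C y z p \<le> sep_prob (e_o n) n C y z p"
      using \<kappa> \<gamma>01 lenC
      by (intro sep_prob_ratio[OF eo et wrong correct inj]) auto
  qed (use inj lenC \<kappa> in auto)
  moreover have "0 < wkt (e_t n k) n C"
    using inj lenC N et n q01 m1 by (intro wkt_pos) (auto simp: flip_t)
  ultimately have "\<kappa> / real N \<le> wkt (e_o n) n C / wkt (e_t n k) n C"
    by (simp add: lenC pos_le_divide_eq)
  then show ?thesis by (simp add: \<kappa>_def \<gamma>_def Y_def)
qed

text \<open>The fourth power of \<open>n / 72 \<le> 2 powr (n / 36)\<close>, which holds since
  \<open>ln 2 \<ge> 1 / 2\<close> and \<open>x \<le> exp x\<close>.\<close>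

lemma pow4_le_powr: "real n ^ 4 \<le> 72 ^ 4 * 2 powr (real n / 9)"
proof -
  have "1 / 2 * (real n / 36) \<le> ln 2 * (real n / 36)"
    using ln2_ge_two_thirds by (intro mult_right_mono) auto
  then have "real n / 72 \<le> exp (ln 2 * (real n / 36))"
    using exp_ge_add_one_self[of "ln 2 * (real n / 36)"] by linarith
  then have "real n / 72 \<le> 2 powr (real n / 36)" by (simp add: powr_def mult.commute)
  then have "(real n / 72) ^ 4 \<le> (2 powr (real n / 36)) ^ 4" by (intro power_mono) auto
  also have "\<dots> = 2 powr (real n / 9)" by (simp add: powr_power)
  finally show ?thesis by (simp add: power_divide field_simps)
qed

text \<open>One constant for all \<open>k\<close>, \<open>n\<close> and \<open>N\<close>:
  \<open>exp (- 4) ^ 2\<close> and 81 come from \<kappa>, \<open>72 ^ 4\<close> from bounding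
  \<open>n ^ 4\<close>, and 2 from \<open>1 / ln N < 2\<close>.\<close>

definition bad_const :: real where "bad_const = exp (- 4) ^ 2 / (2 * 81 * 72 ^ 4)"

lemma is_bad_imp_agree_mid:
  fixes k :: real
  assumes k: "1 \<le> k" and n: "1 \<le> n" and m: "real n / k = real m"
    and C: "C \<in> inputs n N" and N: "2 \<le> N" and bad: "is_bad bad_const k n C"
  shows "\<exists>a<N. \<exists>b<N. a \<noteq> b \<and> agree_mid n m (C ! a) (C ! b)"
proof (rule ccontr)
  let ?g = "exp (- 4) ^ 2 :: real"
  let ?Y = "2 powr (real n * (k - 1) / 2)"
  assume "\<not> ?thesis"
  then have lower: "?g * ?Y / (81 * real n ^ 4 * real N) \<le> wkt (e_o n) n C / wkt (e_t n k) n C"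
    by (intro wkt_ratio_lower_bound[OF k n m C N]) auto
  have len: "length C = N" using C by (simp add: inputs_def)
  have "ln 2 \<le> ln (real N)" using N by simp
  then have lnN: "1 / 2 < ln (real N)" using ln2_ge_two_thirds by linarith
  have "bad_const * 2 powr (real n * (k - 5 / 3) / 6) / (real N * ln (real N)) <
      2 * bad_const * 2 powr (real n * (k - 5 / 3) / 6) / real N"
    using lnN N by (simp add: bad_const_def field_simps)
  also have "\<dots> \<le> 2 * bad_const * (?Y / 2 powr (real n / 9)) / real N"
  proof (intro divide_right_mono mult_left_mono)
    have "real n * 1 \<le> real n * k" using k by (intro mult_left_mono) auto
    \<comment> \<open>The two exponents differ by \<open>n * (k / 3 - 2 / 9)\<close>, which is at
      least \<open>n / 9\<close> for \<open>k \<ge> 1\<close>. This slack pays for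
      \<open>n ^ 4\<close>.\<close>
    then have "real n * (k - 5 / 3) / 6 \<le> real n * (k - 1) / 2 - real n / 9" by (simp add: field_simps)
    then have "2 powr (real n * (k - 5 / 3) / 6) \<le> 2 powr (real n * (k - 1) / 2 - real n / 9)"
      by (intro powr_mono) auto
    then show "2 powr (real n * (k - 5 / 3) / 6) \<le> ?Y / 2 powr (real n / 9)" by (simp add: powr_diff)
  qed (auto simp: bad_const_def)
  also have "\<dots> = ?g * ?Y / (81 * (72 ^ 4 * 2 powr (real n / 9)) * real N)"
    by (simp add: bad_const_def)
  also have "\<dots> \<le> ?g * ?Y / (81 * real n ^ 4 * real N)"
    using pow4_le_powr[of n] n N by (intro divide_left_mono mult_right_mono mult_left_mono) auto
  also note lower
  finally show False using bad by (simp add: is_bad_def len)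
qed

lemma prob_is_bad_le:
  fixes k :: real
  assumes k: "1 \<le> k" and n: "1 \<le> n" and m: "real n / k \<in> \<nat>" and N: "2 \<le> N"
  shows "measure_pmf.prob (input_dist n N) {C. is_bad bad_const k n C} \<le>
    2 * real N ^ 2 / 2 powr (real n / max 3 k)"
proof -
  obtain m where m: "real n / k = real m" using m by (auto elim: Nats_cases)
  have "0 < real m" using k n by (simp add: m[symmetric])
  moreover have "real m \<le> real n" using k by (simp add: m[symmetric] divide_le_eq mult_le_cancel_left1)
  ultimately have m1: "1 \<le> m" "m \<le> n" by auto
  have set: "set_pmf (input_dist n N) = inputs n N"
    by (simp add: input_dist_def set_pmf_of_set inputs_nonempty finite_inputs)
  have "measure_pmf.prob (input_dist n N) {C. is_bad bad_const k n C} \<le>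
      measure_pmf.prob (input_dist n N) {C. \<exists>a<N. \<exists>b<N. a \<noteq> b \<and> agree_mid n m (C ! a) (C ! b)}"
    using is_bad_imp_agree_mid[OF k n m _ N]
    by (intro measure_pmf.finite_measure_mono_AE) (auto simp: AE_measure_pmf_iff set)
  also have "\<dots> \<le> 2 * real N ^ 2 / 2 ^ m" by (rule prob_some_agree_mid_le[OF m1])
  also have "\<dots> \<le> 2 * real N ^ 2 / 2 powr (real n / max 3 k)"
  proof (rule divide_left_mono)
    \<comment> \<open>The union bound gives the exponent \<open>n / k\<close>; it is weakened to the
      claimed one.\<close>
    have "real n / max 3 k \<le> real n / k" using k by (intro divide_left_mono) auto
    then have "2 powr (real n / max 3 k) \<le> 2 powr (real m)" by (simp add: m)
    then show "2 powr (real n / max 3 k) \<le> 2 ^ m" by (simp add: powr_realpow)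
  qed auto
  finally show ?thesis .
qed

lemma card_good_ge:
  fixes k :: real
  assumes k: "1 \<le> k" and n: "1 \<le> n" and m: "real n / k \<in> \<nat>" and N: "2 \<le> N"
    and X: "X = 2 powr (real n / max 3 k) / real N ^ 2" "4 \<le> X"
  shows "1 / 4 * X * real (card (bad_inputs bad_const k n N)) \<le> real (card (good_inputs bad_const k n N))"
proof -
  let ?B = "real (card (bad_inputs bad_const k n N))"
  let ?G = "real (card (good_inputs bad_const k n N))"
  let ?T = "real (card (inputs n N))"
  have pos: "0 < ?T" using finite_inputs inputs_nonempty by (simp add: card_gt_0_iff)
  have "bad_inputs bad_const k n N \<union> good_inputs bad_const k n N = inputs n N"
    by (auto simp: bad_inputs_def good_inputs_def)
  moreover have "card (bad_inputs bad_const k n N \<union> good_inputs bad_const k n N) =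
      card (bad_inputs bad_const k n N) + card (good_inputs bad_const k n N)"
    by (intro card_Un_disjoint)
       (auto simp: bad_inputs_def good_inputs_def intro: finite_subset[OF _ finite_inputs])
  ultimately have T: "?T = ?B + ?G" by simp
  have "inputs n N \<inter> {C. is_bad bad_const k n C} = bad_inputs bad_const k n N"
    by (auto simp: bad_inputs_def)
  then have "?B / ?T \<le> 2 * real N ^ 2 / 2 powr (real n / max 3 k)"
    using prob_is_bad_le[OF k n m N]
    by (simp add: input_dist_def measure_pmf_of_set[OF inputs_nonempty finite_inputs])
  also have "\<dots> = 2 / X" by (simp add: X)
  finally have XB: "X * ?B \<le> 2 * ?T" using pos X(2) by (simp add: field_simps)
  \<comment> \<open>So at most half of the inputs are bad, the total is at most twice the good ones,
    and \<open>X * ?B \<le> 4 * ?G\<close>.\<close>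
  have "4 * ?B \<le> X * ?B" using X(2) by (intro mult_right_mono) auto
  with XB T show ?thesis by simp
qed

theorem theorem8:
  shows "\<exists>c>0.
    (\<exists>D>0. \<forall>(k::real) (n::nat) (N::nat).
        1 \<le> k \<longrightarrow> 1 \<le> n \<longrightarrow> real n / k \<in> \<nat> \<longrightarrow> 2 \<le> N \<longrightarrow>
        measure_pmf.prob (input_dist n N) {C. is_bad c k n C}
          \<le> D * real N ^ 2 / 2 powr (real n / max 3 k))
  \<and> (\<forall>k::real. k > 5 / 3 \<longrightarrow>
      (\<exists>E>0. \<exists>M. \<forall>(n::nat) (N::nat).
        1 \<le> n \<longrightarrow> real n / k \<in> \<nat> \<longrightarrow> 2 \<le> N \<longrightarrow>
        M \<le> 2 powr (real n / max 3 k) / real N ^ 2 \<longrightarrow>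
        real (card (good_inputs c k n N))
          \<ge> E * (2 powr (real n / max 3 k) / real N ^ 2) * real (card (bad_inputs c k n N))))"
proof (rule exI[of _ bad_const], intro conjI allI impI)
  show "0 < bad_const" by (simp add: bad_const_def)
  show "\<exists>D>0. \<forall>(k::real) (n::nat) (N::nat).
        1 \<le> k \<longrightarrow> 1 \<le> n \<longrightarrow> real n / k \<in> \<nat> \<longrightarrow> 2 \<le> N \<longrightarrow>
        measure_pmf.prob (input_dist n N) {C. is_bad bad_const k n C}
          \<le> D * real N ^ 2 / 2 powr (real n / max 3 k)"
    using prob_is_bad_le by (intro exI[of _ 2]) auto
  fix k :: real
  assume "k > 5 / 3"
  then show "\<exists>E>0. \<exists>M. \<forall>(n::nat) (N::nat).
        1 \<le> n \<longrightarrow> real n / k \<in> \<nat> \<longrightarrow> 2 \<le> N \<longrightarrow>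
        M \<le> 2 powr (real n / max 3 k) / real N ^ 2 \<longrightarrow>
        real (card (good_inputs bad_const k n N))
          \<ge> E * (2 powr (real n / max 3 k) / real N ^ 2) * real (card (bad_inputs bad_const k n N))"
    using card_good_ge[OF _ _ _ _ refl, of k]
    \<comment> \<open>The threshold \<open>M = 4\<close> is where bad inputs are guaranteed to make
      up at most half of all inputs.\<close>
    by (intro exI[of _ "1 / 4"] conjI exI[of _ 4] allI impI) auto
qed

end
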